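(* Let $R$ be a ring with $1\neq 0$, let $\Lambda$ be a set, and let $\Delta\subseteq\Lambda\times\Lambda$ satisfy axioms (A1) and (A2). Imposing a well-order on $\Delta$, one may recursively produce the ascending (upper) central series of $G(\Delta)$ by using the following facts: (i) if $\Gamma$ is a normal subset of $\Delta$, then $\Delta\setminus\Gamma$ satisfies (A1) and (A2); (ii) if $\Gamma$ is a normal subset of $\Delta$, then $G(\Delta)/G(\Gamma)\cong G(\Delta\setminus\Gamma)$; (iii) the center of $G(\Delta)$ is equal to $G(\Gamma_1)$, where $\Gamma_1$ is the (normal) subset of $\Delta$ consisting of all its isolated elements; (iv) the union of an ascending chain of normal subsets of $\Delta$ is normal. The ascending central series of $G(\Delta)$ may be trivial, stabilize at an intermediate point, or reach $G(\Delta)$.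
   Context: For a subset $\Delta\subseteq\Lambda\times\Lambda$ the axioms are: (A1) $\Delta$ is irreflexive, that is, $(i,i)\notin\Delta$ for all $i\in\Lambda$; (A2) if $(i,j),(j,k),(k,\ell),(i,\ell)\in\Delta$, then $(i,k)\in\Delta\Leftrightarrow(j,\ell)\in\Delta$. For $\Delta$ satisfying (A1) and (A2), $R\Delta$ is the free $R$-module with basis $\{e_{i,j} : (i,j)\in\Delta\}$, made into a ring (without 1) by $e_{i,j}e_{k,\ell}=e_{i,\ell}$ if $j=k$ and $(i,\ell)\in\Delta$, and $e_{i,j}e_{k,\ell}=0$ otherwise, with $(ae_{i,j})(be_{k,\ell})=ab\,e_{i,j}e_{k,\ell}$ for $a,b\in R$. Every element of $R\Delta$ is nilpotent. Adjoining $1$ gives the ring $R\cdot 1\oplus R\Delta$, whose unit group contains the group $G(\Delta)=\{1+x : x\in R\Delta\}$. The group $G(\Delta\setminus\Gamma)$ in (ii) is the group built in this same way from $\Delta\setminus\Gamma$ in place of $\Delta$. For $\Gamma\subseteq\Delta$, $R\Gamma$ is the $R$-span of all $e_{i,j}$ with $(i,j)\in\Gamma$, and inside $G(\Delta)$ one sets $G(\Gamma)=\{1+x : x\in R\Gamma\}$; it is a normal subgroup of $G(\Delta)$ when $\Gamma$ is normal. A subset $\Gamma$ of $\Delta$ is normal if: $(i,j)\in\Gamma$ and $(j,k),(i,k)\in\Delta$ imply $(i,k)\in\Gamma$; and $(i,j)\in\Gamma$ and $(k,i),(k,j)\in\Delta$ imply $(k,j)\in\Gamma$. An element $(i,j)\in\Delta$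 is isolated if there is no $(j,k)\in\Delta$ such that $(i,k)\in\Delta$, and there is no $(\ell,i)\in\Delta$ such that $(\ell,j)\in\Delta$. The ascending (upper) central series of a group $H$ is the possibly transfinite series that starts at the trivial subgroup, in which each successor term modulo the preceding term $Z$ is the center of $H/Z$, and in which each limit term is the union of the preceding terms. *)

theory Defs
  imports "HOL-Library.Poly_Mapping" "HOL-Algebra.Algebra"
begin

section \<open>Index sets, normal subsets, isolated elements\<close>

definition admissible :: "'i set \<Rightarrow> 'i rel \<Rightarrow> bool" where
  "admissible \<Lambda> \<Delta> \<longleftrightarrow>
     \<Delta> \<subseteq> \<Lambda> \<times> \<Lambda> \<and>
     (\<forall>i\<in>\<Lambda>. (i, i) \<notin> \<Delta>) \<and>
     (\<forall>i j k l. (i, j) \<in> \<Delta> \<longrightarrow> (j, k) \<in> \<Delta> \<longrightarrow> (k, l) \<in> \<Delta> \<longrightarrow> (i, l) \<in> \<Delta> \<longrightarrow>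
        ((i, k) \<in> \<Delta> \<longleftrightarrow> (j, l) \<in> \<Delta>))"

definition normal_subset :: "'i rel \<Rightarrow> 'i rel \<Rightarrow> bool" where
  "normal_subset \<Delta> \<Gamma> \<longleftrightarrow>
     \<Gamma> \<subseteq> \<Delta> \<and>
     (\<forall>i j k. (i, j) \<in> \<Gamma> \<longrightarrow> (j, k) \<in> \<Delta> \<longrightarrow> (i, k) \<in> \<Delta> \<longrightarrow> (i, k) \<in> \<Gamma>) \<and>
     (\<forall>i j k. (i, j) \<in> \<Gamma> \<longrightarrow> (k, i) \<in> \<Delta> \<longrightarrow> (k, j) \<in> \<Delta> \<longrightarrow> (k, j) \<in> \<Gamma>)"

definition isolated :: "'i rel \<Rightarrow> 'i rel" where
  "isolated \<Delta> = {(i, j) \<in> \<Delta>.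
     \<not> (\<exists>k. (j, k) \<in> \<Delta> \<and> (i, k) \<in> \<Delta>) \<and> \<not> (\<exists>l. (l, i) \<in> \<Delta> \<and> (l, j) \<in> \<Delta>)}"

section \<open>The ring and the group attached to an index set\<close>

text \<open>An element of the free module on the symbols \<open>e i j\<close> is a finitely supported function on
  pairs; \<open>Poly_Mapping.single (i, j) a\<close> is \<open>a e i j\<close>. The library multiplication on this type
  (convolution over a monoid of exponents) is unrelated and is not used.\<close>

definition span_of :: "'i rel \<Rightarrow> ('i \<times> 'i \<Rightarrow>\<^sub>0 'r::ring_1) set" where
  "span_of \<Gamma> = {x. Poly_Mapping.keys x \<subseteq> \<Gamma>}"

definition basis_mult ::
    "'i rel \<Rightarrow> 'i \<times> 'i \<Rightarrow> 'r::ring_1 \<Rightarrow> 'i \<times> 'i \<Rightarrow> 'r \<Rightarrow> ('i \<times> 'i \<Rightarrow>\<^sub>0 'r)" where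
  "basis_mult \<Delta> p a q b =
     (if snd p = fst q \<and> (fst p, snd q) \<in> \<Delta>
      then Poly_Mapping.single (fst p, snd q) (a * b) else 0)"

definition span_mult ::
    "'i rel \<Rightarrow> ('i \<times> 'i \<Rightarrow>\<^sub>0 'r::ring_1) \<Rightarrow> ('i \<times> 'i \<Rightarrow>\<^sub>0 'r) \<Rightarrow> ('i \<times> 'i \<Rightarrow>\<^sub>0 'r)" where
  "span_mult \<Delta> x y =
     (\<Sum>p\<in>Poly_Mapping.keys x. \<Sum>q\<in>Poly_Mapping.keys y.
        basis_mult \<Delta> p (Poly_Mapping.lookup x p) q (Poly_Mapping.lookup y q))"

text \<open>The pair \<open>(a, x)\<close> stands for \<open>a 1 + x\<close>. Coefficients commute with the symbols \<open>e i j\<close>, but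
  not necessarily with each other, whence the left and right multiples.\<close>

definition adjoined_ring :: "'i rel \<Rightarrow> ('r::ring_1 \<times> ('i \<times> 'i \<Rightarrow>\<^sub>0 'r)) ring" where
  "adjoined_ring \<Delta> =
     \<lparr>carrier = UNIV \<times> span_of \<Delta>,
      monoid.mult = (\<lambda>(a, x) (b, y). (a * b,
        Poly_Mapping.map (\<lambda>c. a * c) y + Poly_Mapping.map (\<lambda>c. c * b) x + span_mult \<Delta> x y)),
      one = (1, 0),
      ring.zero = (0, 0),
      add = (\<lambda>(a, x) (b, y). (a + b, x + y))\<rparr>"

definition one_plus_span :: "'i rel \<Rightarrow> ('r::ring_1 \<times> ('i \<times> 'i \<Rightarrow>\<^sub>0 'r)) set" where
  "one_plus_span \<Gamma> = {(1, x) | x. x \<in> span_of \<Gamma>}"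

definition pattern_group :: "'i rel \<Rightarrow> ('r::ring_1 \<times> ('i \<times> 'i \<Rightarrow>\<^sub>0 'r)) monoid" where
  "pattern_group \<Delta> = (units_of (adjoined_ring \<Delta>))\<lparr>carrier := one_plus_span \<Delta>\<rparr>"

section \<open>Transfinite iteration along a well-order\<close>

text \<open>For an initial segment \<open>A\<close> of a well-order \<open>r\<close>, \<open>stage\<close> is the term that comes right after
  the terms \<open>f a\<close> with \<open>a \<in> A\<close>: the initial term \<open>z\<close> if \<open>A\<close> is empty, the successor of the last
  term if \<open>A\<close> has a greatest element, and the union at a limit. So \<open>iterate r z s a\<close> is the term
  whose ordinal index is the order type of the elements strictly below \<open>a\<close>, and
  \<open>iterate_end r z s\<close> is the one whose index is the order type of \<open>r\<close> itself.\<close>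

definition stage :: "'o rel \<Rightarrow> 'x set \<Rightarrow> ('x set \<Rightarrow> 'x set) \<Rightarrow> ('o \<Rightarrow> 'x set) \<Rightarrow> 'o set \<Rightarrow> 'x set" where
  "stage r z s f A =
     (if A = {} then z
      else if \<exists>m\<in>A. \<forall>b\<in>A. (b, m) \<in> r then s (f (THE m. m \<in> A \<and> (\<forall>b\<in>A. (b, m) \<in> r)))
      else (\<Union>b\<in>A. f b))"

definition iterate :: "'o rel \<Rightarrow> 'x set \<Rightarrow> ('x set \<Rightarrow> 'x set) \<Rightarrow> 'o \<Rightarrow> 'x set" where
  "iterate r z s = wfrec (r - Id) (\<lambda>f a. stage r z s f (underS r a))"

definition iterate_end :: "'o rel \<Rightarrow> 'x set \<Rightarrow> ('x set \<Rightarrow> 'x set) \<Rightarrow> 'x set" where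
  "iterate_end r z s = stage r z s (iterate r z s) (Field r)"

section \<open>The upper central series\<close>

definition group_center :: "('g, 'b) monoid_scheme \<Rightarrow> 'g set" where
  "group_center H = {z \<in> carrier H. \<forall>x\<in>carrier H. z \<otimes>\<^bsub>H\<^esub> x = x \<otimes>\<^bsub>H\<^esub> z}"

definition central_step :: "('g, 'b) monoid_scheme \<Rightarrow> 'g set \<Rightarrow> 'g set" where
  "central_step H Z = {h \<in> carrier H. Z #>\<^bsub>H\<^esub> h \<in> group_center (H Mod Z)}"

definition upper_central :: "('g, 'b) monoid_scheme \<Rightarrow> 'o rel \<Rightarrow> 'o \<Rightarrow> 'g set" where
  "upper_central H r = iterate r {\<one>\<^bsub>H\<^esub>} (central_step H)"

definition upper_central_end :: "('g, 'b) monoid_scheme \<Rightarrow> 'o rel \<Rightarrow> 'g set" where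
  "upper_central_end H r = iterate_end r {\<one>\<^bsub>H\<^esub>} (central_step H)"

definition isolated_step :: "'i rel \<Rightarrow> 'i rel \<Rightarrow> 'i rel" where
  "isolated_step \<Delta> \<Gamma> = \<Gamma> \<union> isolated (\<Delta> - \<Gamma>)"

definition isolated_series :: "'i rel \<Rightarrow> 'o rel \<Rightarrow> 'o \<Rightarrow> 'i rel" where
  "isolated_series \<Delta> r = iterate r {} (isolated_step \<Delta>)"

definition isolated_series_end :: "'i rel \<Rightarrow> 'o rel \<Rightarrow> 'i rel" where
  "isolated_series_end \<Delta> r = iterate_end r {} (isolated_step \<Delta>)"

text \<open>The series becomes stationary no later than at the index given by the order type of \<open>r\<close>,
  and its final term is \<open>Z\<close>.\<close>

definition upper_central_stabilizes ::
    "('g, 'b) monoid_scheme \<Rightarrow> 'o rel \<Rightarrow> 'g set \<Rightarrow> bool" where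
  "upper_central_stabilizes H r Z \<longleftrightarrow> upper_central_end H r = Z \<and> central_step H Z = Z"

end

theory Submission
  imports Defs
begin

text \<open>In a nonzero product of basis elements all partial products are nonzero, so by irreflexivity
  the indices are distinct; hence every element of the span is nilpotent and \<open>1 + x\<close> is invertible.
  Deleting the coefficients at a normal subset \<open>\<Gamma>\<close> is a homomorphism with kernel \<open>G(\<Gamma>)\<close>, and an
  element commutes with all \<open>1 + e i j\<close> exactly if it is supported on isolated pairs. Hence the upper
  central series is the image under \<open>\<Gamma> \<mapsto> G(\<Gamma>)\<close> of the series that adjoins to \<open>\<Gamma>\<close> the isolated pairs
  of \<open>\<Delta> - \<Gamma>\<close>. This step is monotone in \<open>\<Gamma>\<close>, so that for a suitable well-order of \<open>\<Delta>\<close> the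
  series ends at its least fixed point.\<close>

section \<open>Transfinite iteration of an inflationary step\<close>

lemma stage_greatest:
  assumes "antisym r" "m \<in> A" "\<And>b. b \<in> A \<Longrightarrow> (b, m) \<in> r"
  shows "stage r z s f A = s (f m)"
proof -
  have "(THE m. m \<in> A \<and> (\<forall>b\<in>A. (b, m) \<in> r)) = m"
    using assms by (intro the_equality) (auto dest: antisymD)
  then show ?thesis using assms by (auto simp: stage_def)
qed

lemma stage_limit:
  assumes "A \<noteq> {}" "\<not> (\<exists>m\<in>A. \<forall>b\<in>A. (b, m) \<in> r)"
  shows "stage r z s f A = (\<Union>b\<in>A. f b)"
  using assms by (simp only: stage_def if_False)

lemma stage_cases:
  assumes "antisym r"
  obtains (empty) "A = {}" "stage r z s f A = z"
  | (greatest) m where "m \<in> A" "\<And>b. b \<in> A \<Longrightarrow> (b, m) \<in> r" "stage r z s f A = s (f m)"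
  | (limit) "\<And>b. b \<in> A \<Longrightarrow> \<exists>c\<in>A. (c, b) \<notin> r" "stage r z s f A = (\<Union>b\<in>A. f b)"
proof (cases "\<exists>m\<in>A. \<forall>b\<in>A. (b, m) \<in> r")
  case True
  then show ?thesis using stage_greatest[OF assms] greatest by metis
next
  case False
  then show ?thesis
    using stage_limit[of A r z s f] empty limit by (cases "A = {}") (auto simp: stage_def)
qed

text \<open>Applied to the elements strictly below a given one, this is the admissibility condition
  that lets \<open>wfrec\<close> be unfolded in the definition of \<open>iterate\<close>.\<close>

lemma stage_cong:
  assumes "antisym r" "\<And>b. b \<in> A \<Longrightarrow> f b = g b"
  shows "stage r z s f A = stage r z s g A"
proof (cases "\<exists>m\<in>A. \<forall>b\<in>A. (b, m) \<in> r")
  case True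
  then obtain m where "m \<in> A" "\<And>b. b \<in> A \<Longrightarrow> (b, m) \<in> r" by blast
  then show ?thesis by (simp add: stage_greatest[OF assms(1), of m] assms(2))
next
  case False
  then show ?thesis using assms(2) by (auto simp: stage_def)
qed

lemma iterate_unfold:
  assumes "Well_order r"
  shows "iterate r z s a = stage r z s (iterate r z s) (underS r a)"
proof -
  have as: "antisym r" and wf: "wf (r - Id)"
    using assms by (auto simp: order_on_defs)
  have "adm_wf (r - Id) (\<lambda>f a. stage r z s f (underS r a))"
    unfolding adm_wf_def by (intro allI impI stage_cong[OF as]) (auto simp: underS_def)
  from wfrec_fixpoint[OF wf this] show ?thesis
    unfolding iterate_def by (metis (no_types, lifting))
qed

text \<open>If \<open>b\<close> is greatest in \<open>A\<close>, the stage is \<open>s (f b)\<close>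
  itself. Otherwise \<open>A\<close> has a later element \<open>c\<close>, and
  \<open>s (f b)\<close> lies in \<open>f c\<close>, hence in the stage. Leaving \<open>A\<close>
  and \<open>f\<close> abstract covers both the segments below an element and the whole
  field.\<close>

lemma step_subset_stage:
  assumes r: "Well_order r" and infl: "\<And>U. U \<subseteq> s U"
    and mono: "\<And>b c. (b, c) \<in> r \<Longrightarrow> b \<noteq> c \<Longrightarrow> c \<in> A \<Longrightarrow> s (f b) \<subseteq> f c"
    and A: "A \<subseteq> Field r" "b \<in> A"
  shows "s (f b) \<subseteq> stage r z s f A"
proof -
  have as: "antisym r" and tot: "total_on (Field r) r" and refl: "refl_on (Field r) r"
    using r by (auto simp: order_on_defs)
  from as show ?thesis
  proof (cases rule: stage_cases[where A = A and z = z and s = s and f = f])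
    case empty
    then show ?thesis using A by simp
  next
    case (greatest m)
    have "b = m \<or> s (f b) \<subseteq> f m" using mono greatest(1,2) A(2) by blast
    then show ?thesis unfolding greatest(3) using infl[of "f m"] by auto
  next
    case limit
    obtain c where c: "c \<in> A" "(c, b) \<notin> r" using limit(1)[OF A(2)] by blast
    have F: "b \<in> Field r" "c \<in> Field r" using A c(1) by auto
    have "b \<noteq> c" using refl_onD[OF refl F(1)] c(2) by auto
    then have "(b, c) \<in> r" using tot F c(2) unfolding total_on_def by metis
    then have "s (f b) \<subseteq> f c" using mono[of b c] \<open>b \<noteq> c\<close> c(1) by simp
    then show ?thesis unfolding limit(2) using c(1) by blast
  qed
qed

lemma step_iterate_subset:
  assumes r: "Well_order r" and infl: "\<And>U. U \<subseteq> s U" and "(b, a) \<in> r" "b \<noteq> a"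
  shows "s (iterate r z s b) \<subseteq> iterate r z s a"
proof -
  have wf: "wf (r - Id)" using r by (auto simp: order_on_defs)
  show ?thesis using assms(3,4)
  proof (induction a arbitrary: b rule: wf_induct_rule[OF wf])
    case (1 a)
    show ?case
    proof (subst iterate_unfold[OF r, of _ _ a], rule step_subset_stage[OF r infl])
      show "b \<in> underS r a" using "1.prems" by (auto simp: underS_def)
    next
      fix b c assume bc: "(b, c) \<in> r" "b \<noteq> c" and "c \<in> underS r a"
      then have "(c, a) \<in> r - Id" by (auto simp: underS_def)
      from "1.IH"[OF this bc] show "s (iterate r z s b) \<subseteq> iterate r z s c" .
    next
      show "underS r a \<subseteq> Field r" unfolding underS_def Field_def by blast
    qed
  qed
qed

lemma iterate_mono:
  assumes r: "Well_order r" and infl: "\<And>U. U \<subseteq> s U" and "(b, a) \<in> r"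
  shows "iterate r z s b \<subseteq> iterate r z s a"
proof (cases "b = a")
  case False
  have "iterate r z s b \<subseteq> s (iterate r z s b)" by (rule infl)
  also have "\<dots> \<subseteq> iterate r z s a" by (rule step_iterate_subset[OF r infl assms(3) False])
  finally show ?thesis .
next
  case True
  then show ?thesis by (simp only: subset_refl)
qed

lemma step_iterate_subset_end:
  assumes r: "Well_order r" and infl: "\<And>U. U \<subseteq> s U" and "b \<in> Field r"
  shows "s (iterate r z s b) \<subseteq> iterate_end r z s"
  unfolding iterate_end_def
  by (rule step_subset_stage[OF r infl step_iterate_subset[OF r infl] subset_refl assms(3)])

text \<open>Everything beyond the initial term enters through some application of the step. At a
  limit the element lies in an earlier term \<open>f b\<close>, which \<open>s (f b)\<close>
  contains by inflation.\<close>

lemma in_stage: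
  assumes "Well_order r" "x \<in> stage r z s f A" "x \<notin> z" and infl: "\<And>U. U \<subseteq> s U"
  obtains b where "b \<in> A" "x \<in> s (f b)"
proof -
  have as: "antisym r" using assms(1) by (auto simp: order_on_defs)
  from as show ?thesis
  proof (cases rule: stage_cases[where A = A and z = z and s = s and f = f])
    case limit
    obtain b where "b \<in> A" "x \<in> f b" using assms(2) unfolding limit(2) by blast
    then show ?thesis using that infl[of "f b"] by blast
  qed (use assms that in auto)
qed

text \<open>Two iterations along one well-order run in parallel, related by \<open>P\<close>. The
  premise for a stage may assume that the terms of the first iteration form a chain; limits of spans
  need this, because a finite support lies in one member of a chain.\<close>

lemma iterate_induct:
  assumes r: "Well_order r"
    and stage: "\<And>A f g. A \<subseteq> Field r \<Longrightarrow> (\<And>b. b \<in> A \<Longrightarrow> P (f b) (g b)) \<Longrightarrow>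
      (\<And>b c. b \<in> A \<Longrightarrow> c \<in> A \<Longrightarrow> f b \<subseteq> f c \<or> f c \<subseteq> f b) \<Longrightarrow>
      P (stage r z s f A) (stage r z' s' g A)"
    and infl: "\<And>U. U \<subseteq> s U"
  shows "P (iterate r z s a) (iterate r z' s' a)"
    and "P (iterate_end r z s) (iterate_end r z' s')"
proof -
  have wf: "wf (r - Id)" and tot: "total_on (Field r) r"
    using r by (auto simp: order_on_defs)
  have chain: "iterate r z s b \<subseteq> iterate r z s c \<or> iterate r z s c \<subseteq> iterate r z s b"
    if "b \<in> Field r" "c \<in> Field r" for b c
  proof -
    have "(b, c) \<in> r \<or> (c, b) \<in> r \<or> b = c" using that tot by (auto simp: total_on_def)
    then show ?thesis
      using iterate_mono[where s = s, OF r infl, of b c z]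
        iterate_mono[where s = s, OF r infl, of c b z]
      by auto
  qed
  show *: "P (iterate r z s a) (iterate r z' s' a)" for a
  proof (induction a rule: wf_induct_rule[OF wf])
    case (1 a)
    show ?case
      unfolding iterate_unfold[OF r, of _ _ a]
    proof (rule stage)
      show "underS r a \<subseteq> Field r" by (auto simp: underS_def Field_def)
      show "P (iterate r z s b) (iterate r z' s' b)" if "b \<in> underS r a" for b
        using that by (intro 1) (simp add: underS_def)
    qed (rule chain; auto simp: underS_def Field_def)
  qed
  show "P (iterate_end r z s) (iterate_end r z' s')"
    unfolding iterate_end_def by (rule stage) (use * chain in auto)
qed

text \<open>Ranks are compared first and ties are broken by an arbitrary well-order of
  \<open>A\<close>, so well-foundedness comes from the lexicographic product.\<close>

lemma well_order_on_inv_image_lex: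
  fixes T :: "'a rel" and rank :: "'b \<Rightarrow> 'a"
  assumes T: "Well_order T" "range rank \<subseteq> Field T"
  obtains r where "well_order_on A r"
    "\<And>a b. a \<in> A \<Longrightarrow> b \<in> A \<Longrightarrow> (rank a, rank b) \<in> T - Id \<Longrightarrow> b \<noteq> a \<and> (a, b) \<in> r"
proof -
  obtain r0 where r0: "well_order_on A r0" using well_order_on by blast
  define S where "S = inv_image ((T - Id) <*lex*> (r0 - Id)) (\<lambda>a. (rank a, a))"
  define r where "r = (S \<inter> A \<times> A) \<union> Id_on A"
  have trT: "trans (T - Id)" and trr0: "trans (r0 - Id)"
    using assms(1) r0 by (auto simp: order_on_defs intro: trans_diff_Id)
  have wfS: "wf S" unfolding S_def
    using assms(1) r0 by (intro wf_inv_image wf_lex_prod) (auto simp: order_on_defs)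
  have trS: "trans S" unfolding S_def
    by (intro trans_inv_image trans_lex_prod trT trr0)
  have irr: "(a, a) \<notin> S" for a by (auto simp: S_def)
  have asym: "(a, b) \<notin> S" if "(b, a) \<in> S" for a b
    using trS irr that by (meson transD)
  have tot: "(a, b) \<in> S \<or> (b, a) \<in> S" if "a \<in> A" "b \<in> A" "a \<noteq> b" for a b
  proof (cases "rank a = rank b")
    case True
    then show ?thesis using r0 that by (auto simp: S_def order_on_defs total_on_def)
  next
    case False
    then show ?thesis
      using assms by (simp add: S_def order_on_defs total_on_def) (meson range_subsetD)
  qed
  have "well_order_on A r"
    unfolding order_on_defs
  proof (intro conjI)
    show "trans r" using trS unfolding r_def trans_def by blast
    show "antisym r" using asym by (auto simp: r_def antisym_def)
    show "total_on A r" using tot by (auto simp: r_def total_on_def)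
    show "wf (r - Id)" by (rule wf_subset[OF wfS]) (auto simp: r_def)
  qed (auto simp: r_def refl_on_def)
  then show ?thesis
  proof (rule that)
    fix a b assume "a \<in> A" "b \<in> A" "(rank a, rank b) \<in> T - Id"
    then show "b \<noteq> a \<and> (a, b) \<in> r" by (auto simp: r_def S_def)
  qed
qed

text \<open>If the iteration along a well-order of the power type never became stationary, choosing an
  element that is new at each step would contradict Cantor's theorem.\<close>

lemma ex_iterate_fixpoint:
  fixes s :: "'x set \<Rightarrow> 'x set"
  assumes infl: "\<And>U. U \<subseteq> s U" and T: "Well_order T" "Field T = (UNIV :: 'x set set)"
  obtains t where "s (iterate T z s t) = iterate T z s t"
proof -
  let ?g = "iterate T z s"
  have "\<exists>t. s (?g t) = ?g t"
  proof (rule ccontr)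
    assume "\<nexists>t. s (?g t) = ?g t"
    then have "\<forall>t. \<exists>d. d \<in> s (?g t) - ?g t" using infl by blast
    then obtain d where d: "\<And>t. d t \<in> s (?g t) - ?g t" by metis
    have "inj d"
    proof (rule injI, rule ccontr)
      fix t u assume eq: "d t = d u" and "t \<noteq> u"
      then have "(t, u) \<in> T \<or> (u, t) \<in> T" using T by (auto simp: order_on_defs total_on_def)
      \<comment> \<open>The step at the smaller index is contained in the term at the larger one, so
        the element chosen at the smaller index cannot be new again at the larger.\<close>
      then have "s (?g t) \<subseteq> ?g u \<or> s (?g u) \<subseteq> ?g t"
        using step_iterate_subset[OF T(1) infl] \<open>t \<noteq> u\<close> by metis
      then show False using d[of t] d[of u] eq by auto
    qed
    \<comment> \<open>An inverse of the injection from sets to elements maps the elements onto all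
      their subsets, which Cantor's theorem excludes.\<close>
    then have "range (inv_into UNIV d) = Pow UNIV" by (simp add: inj_imp_surj_inv)
    then show False using Cantors_theorem by blast
  qed
  then show ?thesis using that by blast
qed

text \<open>Elements are ordered by the index at which they enter the iteration, so that each element
  of the fixed point is already in the step applied to its predecessors.\<close>

lemma ex_well_order_iterate_end_eq_lfp:
  fixes s :: "'x set \<Rightarrow> 'x set"
  assumes mono: "mono s" and infl: "\<And>U. U \<subseteq> s U" and A: "lfp s \<subseteq> A"
  obtains r where "well_order_on A r" "iterate_end r {} s = lfp s"
proof -
  obtain T where T: "Well_order T" "Field T = (UNIV :: 'x set set)"
    using well_ordering[where 'a = "'x set"] by (elim exE conjE)
  let ?g = "iterate T {} s"
  have wfT: "wf (T - Id)" and trT: "trans T" and asT: "antisym T"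
    using T by (auto simp: order_on_defs)
  have totT: "(a, b) \<in> T \<or> (b, a) \<in> T" for a b
    using T by (cases "a = b") (auto simp: order_on_defs total_on_def refl_on_def)
  have fix_lfp: "s (lfp s) = lfp s" using lfp_fixpoint[OF mono] .
  have le: "iterate r {} s a \<subseteq> lfp s" "iterate_end r {} s \<subseteq> lfp s"
    if r: "Well_order r" for r :: "'y rel" and a
  proof -
    have *: "stage r {} s f A \<subseteq> lfp s" if f: "\<And>b. b \<in> A \<Longrightarrow> f b \<subseteq> lfp s" for f A
    proof
      fix x assume "x \<in> stage r {} s f A"
      then obtain b where b: "b \<in> A" "x \<in> s (f b)" by (rule in_stage[OF r _ _ infl]) simp
      have "s (f b) \<subseteq> s (lfp s)" by (rule monoD[OF mono f[OF b(1)]])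
      then show "x \<in> lfp s" using b(2) fix_lfp by auto
    qed
    \<comment> \<open>A relation that ignores its second argument turns the paired induction into
      induction along a single iteration.\<close>
    note induct = iterate_induct[OF r _ infl, where P = "\<lambda>U _. U \<subseteq> lfp s"
        and z = "{}" and z' = "{}" and s' = s]
    show "iterate r {} s a \<subseteq> lfp s" by (rule induct(1)) (rule *)
    show "iterate_end r {} s \<subseteq> lfp s" by (rule induct(2)) (rule *)
  qed
  obtain t0 where t0: "s (?g t0) = ?g t0" by (rule ex_iterate_fixpoint[OF infl T])
  then have lfp: "?g t0 = lfp s" using le(1)[OF T(1), of t0] lfp_lowerbound[of s "?g t0"] by simp
  \<comment> \<open>The disjunct \<open>t = t0\<close> provides a rank for every element. It is
    harmless on the least fixed point, since all of that set has entered by the step at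
    \<open>t0\<close>.\<close>
  define Q where "Q d t \<longleftrightarrow> d \<in> s (?g t) \<or> t = t0" for d t
  have "\<exists>t. Q d t \<and> (\<forall>u. (u, t) \<in> T - Id \<longrightarrow> \<not> Q d u)" for d
  proof -
    have t0: "t0 \<in> {t. Q d t}" by (simp add: Q_def)
    show ?thesis using wfT[unfolded wf_eq_minimal, rule_format, OF t0] by auto
  qed
  then obtain rank where rank: "\<forall>d. Q d (rank d) \<and> (\<forall>u. (u, rank d) \<in> T - Id \<longrightarrow> \<not> Q d u)"
    using choice[of "\<lambda>d t. Q d t \<and> (\<forall>u. (u, t) \<in> T - Id \<longrightarrow> \<not> Q d u)"]
    by auto
  obtain r where r: "well_order_on A r"
    and lex: "\<And>a b. a \<in> A \<Longrightarrow> b \<in> A \<Longrightarrow> (rank a, rank b) \<in> T - Id \<Longrightarrow> b \<noteq> a \<and> (a, b) \<in> r"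
    using well_order_on_inv_image_lex[OF T(1), of rank A] T(2) by auto
  have r': "Well_order r" "Field r = A" using r well_order_on_Well_order by blast+
  have wfr: "wf (r - Id)" using r by (auto simp: order_on_defs)
  have enter: "a \<in> s (?g (rank a))" if "a \<in> lfp s" for a
    using rank[rule_format, of a] that lfp t0 by (auto simp: Q_def)
  \<comment> \<open>An element of the term at \<open>t\<close> entered by a step at some
    \<open>u\<close> strictly below \<open>t\<close>, and its rank, being minimal, is at most
    \<open>u\<close>.\<close>
  have pred: "x \<in> lfp s \<and> (rank x, t) \<in> T - Id" if "x \<in> ?g t" for x t
  proof -
    from that obtain u where u: "u \<in> underS T t" "x \<in> s (?g u)"
      unfolding iterate_unfold[OF T(1), of _ _ t] by (rule in_stage[OF T(1) _ _ infl]) simp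
    have "x \<in> lfp s" using le(1)[OF T(1), of t] that by blast
    have "Q x u" using u by (simp add: Q_def)
    then have "(u, rank x) \<notin> T - Id" using rank[rule_format, of x] by blast
    then have "(rank x, u) \<in> T" using totT[of u "rank x"] totT[of u u] by auto
    moreover have "(u, t) \<in> T" "u \<noteq> t" using u(1) by (auto simp: underS_def)
    ultimately have "(rank x, t) \<in> T - Id" using transD[OF trT] antisymD[OF asT, of u t] by auto
    with \<open>x \<in> lfp s\<close> show ?thesis ..
  qed
  \<comment> \<open>Induction along the new order: all elements of \<open>?g (rank a)\<close> have
    smaller rank, so they precede \<open>a\<close> and are already absorbed by the new iteration
    below \<open>a\<close>. Monotonicity of \<open>s\<close> then brings in
    \<open>a\<close>.\<close>
  have "a \<in> s (iterate r {} s a)" if "a \<in> lfp s" for a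
    using that
  proof (induction a rule: wf_induct_rule[OF wfr])
    case (1 a)
    have "?g (rank a) \<subseteq> iterate r {} s a"
    proof
      fix x assume "x \<in> ?g (rank a)"
      then have x: "x \<in> lfp s" "(rank x, rank a) \<in> T - Id" using pred by auto
      then have xa: "(x, a) \<in> r" "x \<noteq> a" using lex[of x a] 1(2) A by auto
      then have "x \<in> s (iterate r {} s x)" using 1(1)[of x] x by simp
      also have "\<dots> \<subseteq> iterate r {} s a" by (rule step_iterate_subset[OF r'(1) infl xa])
      finally show "x \<in> iterate r {} s a" .
    qed
    then show ?case
      using enter[OF 1(2)] monoD[OF mono, of "?g (rank a)" "iterate r {} s a"] by blast
  qed
  moreover have "s (iterate r {} s a) \<subseteq> iterate_end r {} s" if "a \<in> lfp s" for a
    by (rule step_iterate_subset_end[OF r'(1) infl]) (use that r'(2) A in auto)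
  ultimately have "lfp s \<subseteq> iterate_end r {} s" by blast
  then show ?thesis using that[OF r] le(2)[OF r'(1)] by simp
qed

section \<open>Normal subsets and isolated elements\<close>

lemma admissible_irrefl: "admissible \<Lambda> \<Delta> \<Longrightarrow> (i, i) \<notin> \<Delta>"
  by (auto simp: admissible_def)

lemma admissible_iff:
  assumes "admissible \<Lambda> \<Delta>" "(i, j) \<in> \<Delta>" "(j, k) \<in> \<Delta>" "(k, l) \<in> \<Delta>" "(i, l) \<in> \<Delta>"
  shows "(i, k) \<in> \<Delta> \<longleftrightarrow> (j, l) \<in> \<Delta>"
  using assms unfolding admissible_def by blast

lemma admissible_strict_order:
  assumes "trans \<Delta>" "irrefl \<Delta>"
  shows "admissible UNIV \<Delta>"
  unfolding admissible_def
proof (intro conjI allI impI ballI)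
  fix i j k l assume "(i, j) \<in> \<Delta>" "(j, k) \<in> \<Delta>" "(k, l) \<in> \<Delta>"
  then show "(i, k) \<in> \<Delta> \<longleftrightarrow> (j, l) \<in> \<Delta>"
    using transD[OF assms(1), of i j k] transD[OF assms(1), of j k l] by simp
qed (simp_all add: irreflD[OF assms(2)])

text \<open>Axiom (A2) passes from \<open>\<Delta>\<close> to the difference because neither
  \<open>(i, k)\<close> nor \<open>(j, l)\<close> can lie in \<open>\<Gamma>\<close>: by normality,
  together with \<open>(k, l)\<close> or \<open>(i, j)\<close> respectively, either would force
  \<open>(i, l)\<close> into \<open>\<Gamma>\<close>.\<close>

lemma normal_subset_diff_admissible:
  assumes "admissible \<Lambda> \<Delta>" "normal_subset \<Delta> \<Gamma>"
  shows "admissible \<Lambda> (\<Delta> - \<Gamma>)"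
  unfolding admissible_def
proof (intro conjI allI impI)
  fix i j k l
  assume h: "(i, j) \<in> \<Delta> - \<Gamma>" "(j, k) \<in> \<Delta> - \<Gamma>" "(k, l) \<in> \<Delta> - \<Gamma>" "(i, l) \<in> \<Delta> - \<Gamma>"
  then have "(i, k) \<in> \<Delta> \<longleftrightarrow> (j, l) \<in> \<Delta>"
    using admissible_iff[OF assms(1)] by blast
  moreover have "(i, k) \<notin> \<Gamma>" "(j, l) \<notin> \<Gamma>"
    using h assms(2) unfolding normal_subset_def by blast+
  ultimately show "(i, k) \<in> \<Delta> - \<Gamma> \<longleftrightarrow> (j, l) \<in> \<Delta> - \<Gamma>" by blast
qed (use assms(1) in \<open>auto simp: admissible_def\<close>)

lemma normal_subset_empty: "normal_subset \<Delta> {}"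
  by (simp add: normal_subset_def)

text \<open>Let \<open>(i, j)\<close> be isolated in \<open>\<Delta> - \<Gamma>\<close>, with
  \<open>(j, k)\<close> and \<open>(i, k)\<close> in \<open>\<Delta>\<close>. By isolation one of
  these two lies in \<open>\<Gamma>\<close>, and if it is \<open>(j, k)\<close>, normality of
  \<open>\<Gamma>\<close> puts \<open>(i, k)\<close> there as well. The other side is
  symmetric.\<close>

lemma normal_subset_isolated_step:
  assumes "normal_subset \<Delta> \<Gamma>"
  shows "normal_subset \<Delta> (isolated_step \<Delta> \<Gamma>)"
  using assms unfolding normal_subset_def isolated_step_def isolated_def by blast

lemma normal_subset_isolated: "normal_subset \<Delta> (isolated \<Delta>)"
  using normal_subset_isolated_step[OF normal_subset_empty, of \<Delta>]
  by (simp add: isolated_step_def)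

lemma normal_subset_Union:
  assumes "\<And>\<Gamma>. \<Gamma> \<in> \<C> \<Longrightarrow> normal_subset \<Delta> \<Gamma>"
  shows "normal_subset \<Delta> (\<Union>\<C>)"
  using assms unfolding normal_subset_def by blast

lemma isolated_subset: "isolated \<Delta> \<subseteq> \<Delta>"
  by (auto simp: isolated_def)

lemma isolated_step_inflationary: "\<Gamma> \<subseteq> isolated_step \<Delta> \<Gamma>"
  by (simp add: isolated_step_def)

text \<open>Shrinking \<open>\<Delta> - \<Gamma>\<close> only removes the pairs that could prevent a
  remaining pair from being isolated.\<close>

lemma mono_isolated_step: "mono (isolated_step \<Delta>)"
  by (rule monoI) (auto simp: isolated_step_def isolated_def)

section \<open>The nilpotent ring\<close>

lemma lookup_basis_mult:
  "Poly_Mapping.lookup (basis_mult \<Delta> p a q b) (i, l) =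
    (if (i, l) \<in> \<Delta> \<and> fst p = i \<and> q = (snd p, l) then a * b else 0)"
  by (cases p; cases q) (auto simp: basis_mult_def lookup_single when_def)

text \<open>The product is a matrix product truncated to \<open>\<Delta>\<close>. The freedom in
  \<open>J\<close> allows several products to be summed over one common finite index set.\<close>

lemma lookup_span_mult:
  assumes "finite J" "snd ` Poly_Mapping.keys x \<subseteq> J"
  shows "Poly_Mapping.lookup (span_mult \<Delta> x y) (i, l) =
    (if (i, l) \<in> \<Delta>
     then \<Sum>j\<in>J. Poly_Mapping.lookup x (i, j) * Poly_Mapping.lookup y (j, l) else 0)"
proof (cases "(i, l) \<in> \<Delta>")
  case True
  let ?x = "Poly_Mapping.lookup x" and ?y = "Poly_Mapping.lookup y"
  let ?K = "Poly_Mapping.keys x"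
  have J: "j \<in> J" if "?x (i, j) \<noteq> 0" for j
    using assms(2) that by (force simp: in_keys_iff)
  have "Poly_Mapping.lookup (span_mult \<Delta> x y) (i, l) =
      (\<Sum>p\<in>?K. \<Sum>q\<in>Poly_Mapping.keys y.
        if q = (snd p, l) then (if fst p = i then ?x p * ?y q else 0) else 0)"
    unfolding span_mult_def lookup_sum lookup_basis_mult using True
    by (intro sum.cong) auto
  also have "\<dots> = (\<Sum>p\<in>?K. if fst p = i then ?x p * ?y (snd p, l) else 0)"
    by (intro sum.cong refl) (auto simp: sum.delta in_keys_iff)
  also have "\<dots> = (\<Sum>p\<in>{i} \<times> J. ?x p * ?y (snd p, l))"
    using assms(1) J by (intro sum.mono_neutral_cong) (auto simp: in_keys_iff)
  also have "\<dots> = (\<Sum>j\<in>J. ?x (i, j) * ?y (j, l))"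
    by (rule sum.reindex_bij_witness[of _ "Pair i" snd]) auto
  finally show ?thesis using True by simp
next
  case False
  then show ?thesis unfolding span_mult_def lookup_sum lookup_basis_mult by simp
qed

lemma span_mult_in_span: "span_mult \<Delta> x y \<in> span_of \<Delta>"
proof -
  have "Poly_Mapping.lookup (span_mult \<Delta> x y) (i, l) = 0" if "(i, l) \<notin> \<Delta>" for i l
    by (subst lookup_span_mult[OF _ order_refl]) (use that in auto)
  then show ?thesis by (auto simp: span_of_def in_keys_iff)
qed

lemma span_of_zero: "0 \<in> span_of \<Gamma>"
  and span_of_add: "x \<in> span_of \<Gamma> \<Longrightarrow> y \<in> span_of \<Gamma> \<Longrightarrow> x + y \<in> span_of \<Gamma>"
  and span_of_uminus: "x \<in> span_of \<Gamma> \<Longrightarrow> - x \<in> span_of \<Gamma>"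
  and span_of_diff: "x \<in> span_of \<Gamma> \<Longrightarrow> y \<in> span_of \<Gamma> \<Longrightarrow> x - y \<in> span_of \<Gamma>"
  by (force simp: span_of_def in_keys_iff lookup_add lookup_minus subset_eq)+

lemma span_mult_zero_left: "span_mult \<Delta> 0 y = 0"
  by (simp add: span_mult_def)

lemma span_mult_add_left: "span_mult \<Delta> (x + y) z = span_mult \<Delta> x z + span_mult \<Delta> y z"
proof (rule poly_mapping_eqI)
  fix p :: "'a \<times> 'a"
  obtain i l where p: "p = (i, l)" by (cases p)
  let ?J = "snd ` (Poly_Mapping.keys x \<union> Poly_Mapping.keys y \<union> Poly_Mapping.keys (x + y))"
  show "Poly_Mapping.lookup (span_mult \<Delta> (x + y) z) p =
    Poly_Mapping.lookup (span_mult \<Delta> x z + span_mult \<Delta> y z) p"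
    by (simp add: p lookup_add lookup_span_mult[where J = ?J] image_mono distrib_right sum.distrib
        le_supI1 le_supI2)
qed

lemma span_mult_add_right: "span_mult \<Delta> x (y + z) = span_mult \<Delta> x y + span_mult \<Delta> x z"
proof (rule poly_mapping_eqI)
  fix p :: "'a \<times> 'a"
  obtain i l where p: "p = (i, l)" by (cases p)
  show "Poly_Mapping.lookup (span_mult \<Delta> x (y + z)) p =
    Poly_Mapping.lookup (span_mult \<Delta> x y + span_mult \<Delta> x z) p"
    by (simp add: p lookup_add lookup_span_mult[OF _ order_refl] distrib_left sum.distrib)
qed

lemma span_mult_uminus_left: "span_mult \<Delta> (- x) y = - span_mult \<Delta> x y"
  using span_mult_add_left[of \<Delta> "- x" x y]
  by (simp add: span_mult_zero_left eq_neg_iff_add_eq_0)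

lemma span_mult_diff_left: "span_mult \<Delta> (x - y) z = span_mult \<Delta> x z - span_mult \<Delta> y z"
  using span_mult_add_left[of \<Delta> "x - y" y z] by (simp add: eq_diff_eq)

text \<open>Both coefficients at \<open>(i, l)\<close> are double sums over \<open>j\<close> and
  \<open>k\<close>, differing only in whether a term is kept according to \<open>(i, k)\<close> or
  to \<open>(j, l)\<close>. For terms with nonzero factors, (A2) makes these conditions
  equivalent.\<close>

lemma span_mult_assoc:
  assumes \<Delta>: "admissible \<Lambda> \<Delta>" and "x \<in> span_of \<Delta>" "y \<in> span_of \<Delta>" "z \<in> span_of \<Delta>"
  shows "span_mult \<Delta> (span_mult \<Delta> x y) z = span_mult \<Delta> x (span_mult \<Delta> y z)"
proof (rule poly_mapping_eqI)
  fix p :: "'a \<times> 'a"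
  obtain i l where p: "p = (i, l)" by (cases p)
  let ?x = "Poly_Mapping.lookup x" and ?y = "Poly_Mapping.lookup y" and ?z = "Poly_Mapping.lookup z"
  let ?J = "snd ` (Poly_Mapping.keys x \<union> Poly_Mapping.keys y \<union> Poly_Mapping.keys (span_mult \<Delta> x y))"
  have fin: "finite ?J" by simp
  have J: "snd ` Poly_Mapping.keys x \<subseteq> ?J" "snd ` Poly_Mapping.keys y \<subseteq> ?J"
    "snd ` Poly_Mapping.keys (span_mult \<Delta> x y) \<subseteq> ?J" by auto
  note lookup = lookup_span_mult[OF fin J(1)] lookup_span_mult[OF fin J(2)]
    lookup_span_mult[OF fin J(3)]
  have zero: "?x q = 0" "?y q = 0" "?z q = 0" if "q \<notin> \<Delta>" for q
    using assms that by (auto simp: span_of_def in_keys_iff)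
  have eq: "(if (i, k) \<in> \<Delta> then ?x (i, j) * ?y (j, k) else 0) * ?z (k, l) =
      ?x (i, j) * (if (j, l) \<in> \<Delta> then ?y (j, k) * ?z (k, l) else 0)"
    if "(i, l) \<in> \<Delta>" for j k
  proof (cases "(i, j) \<in> \<Delta> \<and> (j, k) \<in> \<Delta> \<and> (k, l) \<in> \<Delta>")
    case True
    then have "(i, k) \<in> \<Delta> \<longleftrightarrow> (j, l) \<in> \<Delta>"
      using admissible_iff[OF \<Delta>] that by blast
    then show ?thesis by (simp add: mult.assoc)
  next
    case False
    then show ?thesis using zero by auto
  qed
  show "Poly_Mapping.lookup (span_mult \<Delta> (span_mult \<Delta> x y) z) p =
    Poly_Mapping.lookup (span_mult \<Delta> x (span_mult \<Delta> y z)) p"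
  proof (cases "(i, l) \<in> \<Delta>")
    case True
    have "Poly_Mapping.lookup (span_mult \<Delta> (span_mult \<Delta> x y) z) p =
        (\<Sum>k\<in>?J. \<Sum>j\<in>?J. (if (i, k) \<in> \<Delta> then ?x (i, j) * ?y (j, k) else 0) * ?z (k, l))"
      using True by (simp add: p lookup(3)) (auto intro!: sum.cong simp: lookup(1) sum_distrib_right)
    also have "\<dots> = (\<Sum>j\<in>?J. \<Sum>k\<in>?J. ?x (i, j) * (if (j, l) \<in> \<Delta> then ?y (j, k) * ?z (k, l) else 0))"
      unfolding eq[OF True] by (rule sum.swap)
    also have "\<dots> = Poly_Mapping.lookup (span_mult \<Delta> x (span_mult \<Delta> y z)) p"
      using True by (simp add: p lookup(1)) (auto intro!: sum.cong simp: lookup(2) sum_distrib_left)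
    finally show ?thesis .
  next
    case False
    then show ?thesis by (simp add: p lookup_span_mult[OF _ order_refl])
  qed
qed

text \<open>The error terms of successive approximations to the inverse of \<open>1 + x\<close> are \<open>\<plusminus> x\<^sup>n\<close>. A basis
  element \<open>e i l\<close> occurs in \<open>x\<^sup>n\<^sup>+\<^sup>1\<close> only if at least \<open>n\<close> of the finitely many indices met by \<open>x\<close> lie
  strictly between \<open>i\<close> and \<open>l\<close>, so \<open>x\<close> is nilpotent.\<close>

lemma ex_left_quasi_inverse:
  fixes x :: "'i \<times> 'i \<Rightarrow>\<^sub>0 'r::ring_1"
  assumes \<Delta>: "admissible \<Lambda> \<Delta>" and x: "x \<in> span_of \<Delta>"
  obtains y where "y \<in> span_of \<Delta>" "y + x + span_mult \<Delta> y x = 0"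
proof -
  \<comment> \<open>Row indices of \<open>x\<close> suffice: an intermediate index \<open>k\<close>
    of a nonzero term in a product \<open>e x\<close> is a row index of \<open>x\<close>. They form
    a finite set, which bounds the count.\<close>
  define between where
    "between i l = {a \<in> fst ` Poly_Mapping.keys x. (i, a) \<in> \<Delta> \<and> (a, l) \<in> \<Delta>}" for i l
  have fin: "finite (between i l)" for i l by (simp add: between_def)
  define close where "close n y \<longleftrightarrow>
    (\<forall>i l. (i, l) \<in> Poly_Mapping.keys (y + x + span_mult \<Delta> y x) \<longrightarrow> n \<le> card (between i l))" for n y
  have approx: "\<exists>y. y \<in> span_of \<Delta> \<and> close n y" for n
  proof (induction n)
    case 0
    show ?case by (rule exI[of _ 0]) (simp add: span_of_zero close_def)
  next
    case (Suc n)
    then obtain y where y: "y \<in> span_of \<Delta>" "close n y" by blast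
    define e where "e = y + x + span_mult \<Delta> y x"
    \<comment> \<open>Solving \<open>y + x + y x = 0\<close> for the first \<open>y\<close> gives
      the next approximation. Its error is \<open>- (e x)\<close>, by distributivity alone.\<close>
    define y' where "y' = - x - span_mult \<Delta> y x"
    have e: "e \<in> span_of \<Delta>" unfolding e_def by (intro span_of_add x y(1) span_mult_in_span)
    have "y' + x + span_mult \<Delta> y' x = - span_mult \<Delta> e x"
      by (simp add: y'_def e_def span_mult_add_left span_mult_diff_left span_mult_uminus_left)
    moreover have "Suc n \<le> card (between i l)"
      if "(i, l) \<in> Poly_Mapping.keys (span_mult \<Delta> e x)" for i l
    proof -
      have il: "(i, l) \<in> \<Delta>" using that span_mult_in_span[of \<Delta> e x] by (auto simp: span_of_def)
      have "(\<Sum>j\<in>snd ` Poly_Mapping.keys e.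
          Poly_Mapping.lookup e (i, j) * Poly_Mapping.lookup x (j, l)) \<noteq> 0"
        using that il by (simp add: in_keys_iff lookup_span_mult[OF _ order_refl])
      then obtain k where "Poly_Mapping.lookup e (i, k) * Poly_Mapping.lookup x (k, l) \<noteq> 0"
        by (rule sum.not_neutral_contains_not_neutral)
      then have k: "(i, k) \<in> Poly_Mapping.keys e" "(k, l) \<in> Poly_Mapping.keys x"
        by (auto simp: in_keys_iff)
      then have kD: "(i, k) \<in> \<Delta>" "(k, l) \<in> \<Delta>" using e x by (auto simp: span_of_def)
      have "k \<notin> between i k" by (simp add: between_def admissible_irrefl[OF \<Delta>])
      \<comment> \<open>For \<open>a\<close> between \<open>i\<close> and \<open>k\<close>, (A2)
        applied to \<open>i\<close>, \<open>a\<close>, \<open>k\<close>, \<open>l\<close> turns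
        \<open>(i, k) \<in> \<Delta>\<close> into \<open>(a, l) \<in> \<Delta>\<close>. Together
        with the new index \<open>k\<close> the count grows by at least one.\<close>
      moreover have "insert k (between i k) \<subseteq> between i l"
      proof
        fix a assume "a \<in> insert k (between i k)"
        then show "a \<in> between i l"
          using k(2) kD admissible_iff[OF \<Delta> _ _ kD(2) il, of a]
          by (auto simp: between_def intro: rev_image_eqI)
      qed
      ultimately have "Suc (card (between i k)) \<le> card (between i l)"
        using card_mono[OF fin[of i l], of "insert k (between i k)"] fin[of i k] by simp
      moreover have "n \<le> card (between i k)" using y(2) k(1) by (simp add: close_def e_def)
      ultimately show ?thesis by simp
    qed
    moreover have "y' \<in> span_of \<Delta>"
      unfolding y'_def by (intro span_of_diff span_of_uminus x span_mult_in_span)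
    ultimately show ?case by (intro exI[of _ y']) (simp add: close_def)
  qed
  \<comment> \<open>One more than the number of available row indices: no pair can meet this bound,
    so the error vanishes.\<close>
  obtain y where y: "y \<in> span_of \<Delta>" "close (Suc (card (fst ` Poly_Mapping.keys x))) y"
    using approx by blast
  have bound: "card (between i l) \<le> card (fst ` Poly_Mapping.keys x)" for i l
    unfolding between_def by (intro card_mono) auto
  have "(i, l) \<notin> Poly_Mapping.keys (y + x + span_mult \<Delta> y x)" for i l
  proof
    assume "(i, l) \<in> Poly_Mapping.keys (y + x + span_mult \<Delta> y x)"
    then have "Suc (card (fst ` Poly_Mapping.keys x)) \<le> card (between i l)"
      using y(2) by (simp add: close_def)
    then show False using bound[of i l] by simp
  qed
  then have "Poly_Mapping.keys (y + x + span_mult \<Delta> y x) = {}"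
    by (auto simp del: keys_eq_empty)
  then show ?thesis using that y(1) by simp
qed

section \<open>The group, its quotients and its center\<close>

lemma carrier_pattern_group: "carrier (pattern_group \<Delta>) = one_plus_span \<Delta>"
  and one_pattern_group: "\<one>\<^bsub>pattern_group \<Delta>\<^esub> = (1, 0)"
  by (simp_all add: pattern_group_def units_of_def adjoined_ring_def)

lemma mult_pattern_group:
  "(1, x) \<otimes>\<^bsub>pattern_group \<Delta>\<^esub> (1, y) = (1, y + x + span_mult \<Delta> x y)"
proof -
  have "Poly_Mapping.map ((*) 1) y = y" "Poly_Mapping.map (\<lambda>c. c * 1) x = x"
    by (auto intro!: poly_mapping_eqI simp: map.rep_eq when_def)
  then show ?thesis by (simp add: pattern_group_def units_of_def adjoined_ring_def)
qed

lemma group_pattern_group: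
  assumes \<Delta>: "admissible \<Lambda> \<Delta>"
  shows "group (pattern_group \<Delta> :: ('r::ring_1 \<times> ('i \<times> 'i \<Rightarrow>\<^sub>0 'r)) monoid)"
proof (rule groupI)
  let ?G = "pattern_group \<Delta> :: ('r \<times> ('i \<times> 'i \<Rightarrow>\<^sub>0 'r)) monoid"
  note simps = carrier_pattern_group one_pattern_group mult_pattern_group one_plus_span_def
  show "a \<otimes>\<^bsub>?G\<^esub> b \<in> carrier ?G" if "a \<in> carrier ?G" "b \<in> carrier ?G" for a b
    using that by (auto simp: simps intro!: span_of_add span_mult_in_span)
  show "\<one>\<^bsub>?G\<^esub> \<in> carrier ?G"
    by (simp add: simps span_of_zero)
  show "a \<otimes>\<^bsub>?G\<^esub> b \<otimes>\<^bsub>?G\<^esub> c = a \<otimes>\<^bsub>?G\<^esub> (b \<otimes>\<^bsub>?G\<^esub> c)"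
    if "a \<in> carrier ?G" "b \<in> carrier ?G" "c \<in> carrier ?G" for a b c
    using that
    by (auto simp: simps span_mult_add_left span_mult_add_right span_mult_assoc[OF \<Delta>] add_ac)
  show "\<one>\<^bsub>?G\<^esub> \<otimes>\<^bsub>?G\<^esub> a = a" if "a \<in> carrier ?G" for a
    using that by (auto simp: simps span_mult_zero_left)
  \<comment> \<open>The rule \<open>groupI\<close> asks for left inverses, which is why a left
    quasi-inverse is enough.\<close>
  show "\<exists>b\<in>carrier ?G. b \<otimes>\<^bsub>?G\<^esub> a = \<one>\<^bsub>?G\<^esub>" if "a \<in> carrier ?G" for a
  proof -
    from that obtain x where x: "a = (1, x)" "x \<in> span_of \<Delta>" by (auto simp: simps)
    obtain y where "y \<in> span_of \<Delta>" "y + x + span_mult \<Delta> y x = 0"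
      by (rule ex_left_quasi_inverse[OF \<Delta> x(2)])
    then show ?thesis by (intro bexI[of _ "(1, y)"]) (auto simp: simps x(1) add_ac)
  qed
qed

section \<open>The center: products with basis elements and with isolated elements\<close>

lemma span_mult_single_left:
  "Poly_Mapping.lookup (span_mult \<Delta> (Poly_Mapping.single (h, j) a) y) (i, l) =
    (if (i, l) \<in> \<Delta> \<and> i = h then a * Poly_Mapping.lookup y (j, l) else 0)"
  by (subst lookup_span_mult[where J = "{j}"]) (auto simp: lookup_single when_def split: if_splits)

lemma span_mult_single_right:
  "Poly_Mapping.lookup (span_mult \<Delta> x (Poly_Mapping.single (j, k) a)) (i, l) =
    (if (i, l) \<in> \<Delta> \<and> l = k then Poly_Mapping.lookup x (i, j) * a else 0)"
proof -
  let ?J = "insert j (snd ` Poly_Mapping.keys x)"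
  have "(\<Sum>j'\<in>?J.
      Poly_Mapping.lookup x (i, j') * Poly_Mapping.lookup (Poly_Mapping.single (j, k) a) (j', l))
    = (\<Sum>j'\<in>?J. if j' = j then (if l = k then Poly_Mapping.lookup x (i, j') * a else 0) else 0)"
    by (intro sum.cong refl) (auto simp: lookup_single when_def)
  then show ?thesis
    by (subst lookup_span_mult[where J = ?J]) auto
qed

text \<open>A pair that is a factor of a nonzero product of two basis elements is not isolated, by
  the very definition of isolation.\<close>

lemma span_mult_isolated:
  assumes z: "z \<in> span_of (isolated \<Delta>)" and x: "x \<in> span_of \<Delta>"
  shows "span_mult \<Delta> z x = 0" "span_mult \<Delta> x z = 0"
proof -
  have z0: "Poly_Mapping.lookup z p = 0" if "p \<notin> isolated \<Delta>" for p
    using z that by (auto simp: span_of_def in_keys_iff)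
  have x0: "Poly_Mapping.lookup x p = 0" if "p \<notin> \<Delta>" for p
    using x that by (auto simp: span_of_def in_keys_iff)
  have "Poly_Mapping.lookup z (i, j) * Poly_Mapping.lookup x (j, l) = 0 \<and>
      Poly_Mapping.lookup x (i, j) * Poly_Mapping.lookup z (j, l) = 0" if "(i, l) \<in> \<Delta>" for i j l
  proof -
    have "(i, j) \<notin> isolated \<Delta> \<or> (j, l) \<notin> \<Delta>" "(j, l) \<notin> isolated \<Delta> \<or> (i, j) \<notin> \<Delta>"
      using that unfolding isolated_def by blast+
    then show ?thesis using x0 z0 by auto
  qed
  then show "span_mult \<Delta> z x = 0" "span_mult \<Delta> x z = 0"
    by (auto intro!: poly_mapping_eqI simp: lookup_span_mult[OF _ order_refl])
qed

lemma center_pattern_group: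
  assumes \<Delta>: "admissible \<Lambda> \<Delta>"
  shows "group_center (pattern_group \<Delta> :: ('r::ring_1 \<times> ('i \<times> 'i \<Rightarrow>\<^sub>0 'r)) monoid) =
    one_plus_span (isolated \<Delta>)"
proof (intro equalityI subsetI)
  let ?G = "pattern_group \<Delta> :: ('r \<times> ('i \<times> 'i \<Rightarrow>\<^sub>0 'r)) monoid"
  note simps = carrier_pattern_group mult_pattern_group one_plus_span_def
  fix g assume g: "g \<in> group_center ?G"
  then obtain z where z: "g = (1, z)" "z \<in> span_of \<Delta>" by (auto simp: group_center_def simps)
  have comm: "span_mult \<Delta> z (Poly_Mapping.single p 1) = span_mult \<Delta> (Poly_Mapping.single p 1) z"
    if "p \<in> \<Delta>" for p
  proof -
    have "(1, Poly_Mapping.single p 1) \<in> carrier ?G" using that by (simp add: simps span_of_def)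
    then show ?thesis using g by (simp add: group_center_def simps z(1) add_ac)
  qed
  have "(i, j) \<in> isolated \<Delta>" if "(i, j) \<in> Poly_Mapping.keys z" for i j
  proof -
    have ij: "(i, j) \<in> \<Delta>" "Poly_Mapping.lookup z (i, j) \<noteq> 0"
      using that z(2) by (auto simp: span_of_def in_keys_iff)
    note irrefl = admissible_irrefl[OF \<Delta>]
    \<comment> \<open>Here \<open>z\<close> times \<open>e j k\<close> has at \<open>(i, k)\<close>
      the nonzero coefficient of \<open>z\<close> at \<open>(i, j)\<close>, while
      \<open>e j k\<close> times \<open>z\<close> lives in row \<open>j\<close>, and
      \<open>i\<close> differs from \<open>j\<close> by irreflexivity. The left-hand obstruction is
      handled symmetrically.\<close>
    have False if "(j, k) \<in> \<Delta>" "(i, k) \<in> \<Delta>" for k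
    proof -
      have "Poly_Mapping.lookup (span_mult \<Delta> z (Poly_Mapping.single (j, k) 1)) (i, k) =
          Poly_Mapping.lookup (span_mult \<Delta> (Poly_Mapping.single (j, k) 1) z) (i, k)"
        by (simp only: comm[OF that(1)])
      then show False using that ij irrefl
        by (auto simp: span_mult_single_left span_mult_single_right split: if_splits)
    qed
    moreover have False if "(l, i) \<in> \<Delta>" "(l, j) \<in> \<Delta>" for l
    proof -
      have "Poly_Mapping.lookup (span_mult \<Delta> z (Poly_Mapping.single (l, i) 1)) (l, j) =
          Poly_Mapping.lookup (span_mult \<Delta> (Poly_Mapping.single (l, i) 1) z) (l, j)"
        by (simp only: comm[OF that(1)])
      then show False using that ij irrefl
        by (auto simp: span_mult_single_left span_mult_single_right split: if_splits)
    qed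
    ultimately show ?thesis using ij by (auto simp: isolated_def)
  qed
  then show "g \<in> one_plus_span (isolated \<Delta>)" by (auto simp: z(1) one_plus_span_def span_of_def)
next
  let ?G = "pattern_group \<Delta> :: ('r \<times> ('i \<times> 'i \<Rightarrow>\<^sub>0 'r)) monoid"
  note simps = carrier_pattern_group mult_pattern_group one_plus_span_def
  fix g :: "'r \<times> ('i \<times> 'i \<Rightarrow>\<^sub>0 'r)" assume "g \<in> one_plus_span (isolated \<Delta>)"
  then obtain z where z: "g = (1, z)" "z \<in> span_of (isolated \<Delta>)" by (auto simp: simps)
  then have "z \<in> span_of \<Delta>" using isolated_subset by (auto simp: span_of_def)
  then show "g \<in> group_center ?G"
    by (auto simp: group_center_def simps z(1) span_mult_isolated[OF z(2)] add_ac)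
qed

section \<open>Quotients by normal subsets, via restriction of supports\<close>

definition restrict_keys :: "'k set \<Rightarrow> ('k \<Rightarrow>\<^sub>0 'r::zero) \<Rightarrow> ('k \<Rightarrow>\<^sub>0 'r)" where
  "restrict_keys S x = Poly_Mapping.mapp (\<lambda>k c. if k \<in> S then c else 0) x"

lemma lookup_restrict_keys:
  "Poly_Mapping.lookup (restrict_keys S x) k = (if k \<in> S then Poly_Mapping.lookup x k else 0)"
  by (simp add: restrict_keys_def lookup_mapp in_keys_iff when_def)

lemma keys_restrict_keys: "Poly_Mapping.keys (restrict_keys S x) = Poly_Mapping.keys x \<inter> S"
  by (auto simp: in_keys_iff lookup_restrict_keys split: if_splits)

lemma restrict_keys_add:
  "restrict_keys S (x + y) = restrict_keys S x + restrict_keys S (y :: _ \<Rightarrow>\<^sub>0 _::monoid_add)"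
  by (auto intro!: poly_mapping_eqI simp: lookup_restrict_keys lookup_add)

text \<open>A product of basis elements landing at \<open>(i, l)\<close> outside
  \<open>\<Gamma>\<close> has both factors outside \<open>\<Gamma>\<close>, by normality. Deleting
  coefficients at \<open>\<Gamma>\<close> beforehand therefore changes nothing there.\<close>

lemma restrict_keys_span_mult:
  assumes \<Gamma>: "normal_subset \<Delta> \<Gamma>" and x: "x \<in> span_of \<Delta>" and y: "y \<in> span_of \<Delta>"
  shows "restrict_keys (\<Delta> - \<Gamma>) (span_mult \<Delta> x y) =
    span_mult (\<Delta> - \<Gamma>) (restrict_keys (\<Delta> - \<Gamma>) x) (restrict_keys (\<Delta> - \<Gamma>) y)"
proof (rule poly_mapping_eqI)
  fix p :: "'a \<times> 'a"
  obtain i l where p: "p = (i, l)" by (cases p)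
  let ?x = "Poly_Mapping.lookup x" and ?y = "Poly_Mapping.lookup y"
  have "?x (i, j) * ?y (j, l) = Poly_Mapping.lookup (restrict_keys (\<Delta> - \<Gamma>) x) (i, j) *
      Poly_Mapping.lookup (restrict_keys (\<Delta> - \<Gamma>) y) (j, l)" if "(i, l) \<in> \<Delta> - \<Gamma>" for j
  proof (cases "(i, j) \<in> \<Delta> \<and> (j, l) \<in> \<Delta>")
    case True
    then have "(i, j) \<notin> \<Gamma>" "(j, l) \<notin> \<Gamma>" using \<Gamma> that unfolding normal_subset_def by blast+
    then show ?thesis using True by (simp add: lookup_restrict_keys)
  next
    case False
    then have "?x (i, j) = 0 \<or> ?y (j, l) = 0" using x y by (auto simp: span_of_def in_keys_iff)
    then show ?thesis by (auto simp: lookup_restrict_keys)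
  qed
  moreover have "snd ` Poly_Mapping.keys (restrict_keys (\<Delta> - \<Gamma>) x) \<subseteq> snd ` Poly_Mapping.keys x"
    by (auto simp: keys_restrict_keys)
  ultimately show "Poly_Mapping.lookup (restrict_keys (\<Delta> - \<Gamma>) (span_mult \<Delta> x y)) p =
    Poly_Mapping.lookup
      (span_mult (\<Delta> - \<Gamma>) (restrict_keys (\<Delta> - \<Gamma>) x) (restrict_keys (\<Delta> - \<Gamma>) y)) p"
    by (auto simp: p lookup_restrict_keys lookup_span_mult[where J = "snd ` Poly_Mapping.keys x"]
        intro!: sum.cong)
qed

lemma restriction_hom:
  assumes \<Delta>: "admissible \<Lambda> \<Delta>" and \<Gamma>: "normal_subset \<Delta> \<Gamma>"
  defines "h \<equiv> apsnd (restrict_keys (\<Delta> - \<Gamma>)) :: ('r::ring_1 \<times> ('i \<times> 'i \<Rightarrow>\<^sub>0 'r)) \<Rightarrow> _"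
  shows "group_hom (pattern_group \<Delta>) (pattern_group (\<Delta> - \<Gamma>)) h"
    and "kernel (pattern_group \<Delta>) (pattern_group (\<Delta> - \<Gamma>)) h = one_plus_span \<Gamma>"
    and "h ` carrier (pattern_group \<Delta>) = carrier (pattern_group (\<Delta> - \<Gamma>))"
proof -
  note simps = carrier_pattern_group one_pattern_group mult_pattern_group one_plus_span_def
    span_of_def h_def
  have sub: "\<Gamma> \<subseteq> \<Delta>" using \<Gamma> by (simp add: normal_subset_def)
  have "h \<in> hom (pattern_group \<Delta>) (pattern_group (\<Delta> - \<Gamma>))"
    using restrict_keys_span_mult[OF \<Gamma>]
    by (auto simp: hom_def simps keys_restrict_keys restrict_keys_add)
  then show "group_hom (pattern_group \<Delta>) (pattern_group (\<Delta> - \<Gamma>)) h"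
    using group_pattern_group[OF \<Delta>] group_pattern_group[OF normal_subset_diff_admissible[OF \<Delta> \<Gamma>]]
    by (simp add: group_hom_def group_hom_axioms_def)
  have "restrict_keys (\<Delta> - \<Gamma>) x = 0 \<longleftrightarrow> Poly_Mapping.keys x \<subseteq> \<Gamma>"
    if "Poly_Mapping.keys x \<subseteq> \<Delta>" for x :: "'i \<times> 'i \<Rightarrow>\<^sub>0 'r"
    using that unfolding keys_eq_empty[symmetric] keys_restrict_keys by blast
  then show "kernel (pattern_group \<Delta>) (pattern_group (\<Delta> - \<Gamma>)) h = one_plus_span \<Gamma>"
    using sub by (auto simp: kernel_def simps)
  have "restrict_keys (\<Delta> - \<Gamma>) x = x"
    if "Poly_Mapping.keys x \<subseteq> \<Delta> - \<Gamma>" for x :: "'i \<times> 'i \<Rightarrow>\<^sub>0 'r"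
    using that by (intro poly_mapping_eqI) (auto simp: lookup_restrict_keys in_keys_iff)
  then have "one_plus_span (\<Delta> - \<Gamma>) \<subseteq> h ` one_plus_span \<Delta>"
    by (force simp: simps image_iff)
  then show "h ` carrier (pattern_group \<Delta>) = carrier (pattern_group (\<Delta> - \<Gamma>))"
    unfolding carrier_pattern_group by (auto simp: simps keys_restrict_keys)
qed

lemma (in group_hom) r_coset_kernel_eq_iff:
  assumes "a \<in> carrier G" "b \<in> carrier G"
  shows "kernel G H h #> a = kernel G H h #> b \<longleftrightarrow> h a = h b"
proof
  have sub: "subgroup (kernel G H h) G" by (rule subgroup_kernel)
  show "h a = h b" if "kernel G H h #> a = kernel G H h #> b"
  proof -
    have "a \<in> kernel G H h #> b" using that G.rcos_self[OF assms(1) sub] by simp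
    then show ?thesis using assms by (auto simp: r_coset_def kernel_def)
  qed
  show "kernel G H h #> a = kernel G H h #> b" if "h a = h b"
  proof -
    have "a \<otimes> inv b \<in> kernel G H h" using assms that by (simp add: kernel_def)
    then have "a \<in> kernel G H h #> b"
      using G.rcosI[of "a \<otimes> inv b" "kernel G H h" b] assms
      by (auto simp: G.m_assoc kernel_def)
    then show ?thesis using G.repr_independence[OF _ assms(2) sub] by simp
  qed
qed

text \<open>Cosets of the kernel correspond to values of \<open>h\<close>, so a coset is central
  exactly if \<open>h g\<close> commutes with all values of \<open>h\<close>; by surjectivity these
  are all of \<open>H\<close>.\<close>

lemma (in group_hom) central_step_kernel:
  assumes surj: "h ` carrier G = carrier H"
  shows "central_step G (kernel G H h) = {g \<in> carrier G. h g \<in> group_center H}"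
proof -
  interpret N: normal "kernel G H h" G by (rule normal_kernel)
  have "kernel G H h #> g \<in> group_center (G Mod kernel G H h) \<longleftrightarrow> h g \<in> group_center H"
    if g: "g \<in> carrier G" for g
  proof -
    have "kernel G H h #> g \<in> group_center (G Mod kernel G H h) \<longleftrightarrow>
        (\<forall>k\<in>carrier G. kernel G H h #> (g \<otimes> k) = kernel G H h #> (k \<otimes> g))"
      using g by (auto simp: group_center_def carrier_FactGroup N.rcos_sum)
    also have "\<dots> \<longleftrightarrow> (\<forall>k\<in>carrier G. h g \<otimes>\<^bsub>H\<^esub> h k = h k \<otimes>\<^bsub>H\<^esub> h g)"
      using g by (simp add: r_coset_kernel_eq_iff)
    also have "\<dots> \<longleftrightarrow> h g \<in> group_center H"
      using g by (auto simp: group_center_def surj[symmetric])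
    finally show ?thesis .
  qed
  then show ?thesis by (auto simp: central_step_def)
qed

text \<open>The preimage of the center under restriction consists of the elements whose support
  outside \<open>\<Gamma>\<close> is isolated in \<open>\<Delta> - \<Gamma>\<close>.\<close>

lemma central_step_pattern_group:
  assumes \<Delta>: "admissible \<Lambda> \<Delta>" and \<Gamma>: "normal_subset \<Delta> \<Gamma>"
  shows "central_step (pattern_group \<Delta> :: ('r::ring_1 \<times> ('i \<times> 'i \<Rightarrow>\<^sub>0 'r)) monoid)
    (one_plus_span \<Gamma>) = one_plus_span (isolated_step \<Delta> \<Gamma>)"
proof -
  define h :: "('r \<times> ('i \<times> 'i \<Rightarrow>\<^sub>0 'r)) \<Rightarrow> _" where "h = apsnd (restrict_keys (\<Delta> - \<Gamma>))"
  interpret group_hom "pattern_group \<Delta>" "pattern_group (\<Delta> - \<Gamma>)" h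
    unfolding h_def by (rule restriction_hom[OF \<Delta> \<Gamma>])
  have "central_step (pattern_group \<Delta>) (one_plus_span \<Gamma> :: ('r \<times> ('i \<times> 'i \<Rightarrow>\<^sub>0 'r)) set) =
      {g \<in> one_plus_span \<Delta>. h g \<in> one_plus_span (isolated (\<Delta> - \<Gamma>))}"
    using central_step_kernel restriction_hom(2,3)[OF \<Delta> \<Gamma>, where 'r = 'r]
    by (simp add: h_def carrier_pattern_group
        center_pattern_group[OF normal_subset_diff_admissible[OF \<Delta> \<Gamma>]])
  also have "\<dots> = one_plus_span (isolated_step \<Delta> \<Gamma>)"
  proof -
    have eq: "K \<subseteq> \<Delta> \<and> K \<inter> (\<Delta> - \<Gamma>) \<subseteq> isolated (\<Delta> - \<Gamma>) \<longleftrightarrow> K \<subseteq> isolated_step \<Delta> \<Gamma>" for K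
      using \<Gamma> isolated_subset[of "\<Delta> - \<Gamma>"]
      unfolding normal_subset_def isolated_step_def by blast
    have "{g \<in> one_plus_span \<Delta>. h g \<in> one_plus_span (isolated (\<Delta> - \<Gamma>))} =
        {(1, x) |x. Poly_Mapping.keys x \<subseteq> \<Delta> \<and>
          Poly_Mapping.keys x \<inter> (\<Delta> - \<Gamma>) \<subseteq> isolated (\<Delta> - \<Gamma>)}"
      by (auto simp: one_plus_span_def span_of_def h_def keys_restrict_keys; blast)
    then show ?thesis by (simp only: eq one_plus_span_def span_of_def mem_Collect_eq)
  qed
  finally show ?thesis .
qed

lemma one_plus_span_empty: "one_plus_span {} = {(1, 0)}"
  by (auto simp: one_plus_span_def span_of_def)

lemma one_plus_span_psubset:
  assumes "\<Gamma> \<subset> \<Delta>"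
  shows "(one_plus_span \<Gamma> :: ('r::ring_1 \<times> ('i \<times> 'i \<Rightarrow>\<^sub>0 'r)) set) \<subset> one_plus_span \<Delta>"
proof -
  obtain p where p: "p \<in> \<Delta>" "p \<notin> \<Gamma>" using assms by blast
  \<comment> \<open>This element separates the two sets because \<open>1\<close> is nonzero in a
    \<open>ring_1\<close>.\<close>
  then have "(1 :: 'r, Poly_Mapping.single p (1 :: 'r)) \<in> one_plus_span \<Delta> - one_plus_span \<Gamma>"
    by (auto simp: one_plus_span_def span_of_def)
  moreover have "(one_plus_span \<Gamma> :: ('r \<times> ('i \<times> 'i \<Rightarrow>\<^sub>0 'r)) set) \<subseteq> one_plus_span \<Delta>"
    using assms by (auto simp: one_plus_span_def span_of_def)
  ultimately show ?thesis by blast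
qed

text \<open>A finite support inside the union of a nonempty chain lies in one of its members. For
  empty \<open>A\<close> the left side would still contain the identity.\<close>

lemma one_plus_span_Union_chain:
  fixes f :: "'o \<Rightarrow> 'i rel"
  assumes "A \<noteq> {}" "\<And>b c. b \<in> A \<Longrightarrow> c \<in> A \<Longrightarrow> f b \<subseteq> f c \<or> f c \<subseteq> f b"
  shows "(one_plus_span (\<Union>b\<in>A. f b) :: ('r::ring_1 \<times> ('i \<times> 'i \<Rightarrow>\<^sub>0 'r)) set) =
    (\<Union>b\<in>A. one_plus_span (f b))"
proof -
  have "subset.chain UNIV (f ` A)" using assms(2) by (auto simp: subset_chain_def)
  then have "\<exists>b\<in>A. Poly_Mapping.keys x \<subseteq> f b" if "Poly_Mapping.keys x \<subseteq> (\<Union>b\<in>A. f b)"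
    for x :: "'i \<times> 'i \<Rightarrow>\<^sub>0 'r"
    using finite_subset_Union_chain[OF finite_keys that] assms(1) by blast
  then show ?thesis unfolding one_plus_span_def span_of_def by blast
qed

section \<open>The upper central series\<close>

lemma upper_central_pattern_group:
  assumes \<Delta>: "admissible \<Lambda> \<Delta>" and r: "Well_order r"
  defines "G \<equiv> (pattern_group \<Delta> :: ('r::ring_1 \<times> ('i \<times> 'i \<Rightarrow>\<^sub>0 'r)) monoid)"
  shows "normal_subset \<Delta> (isolated_series \<Delta> r a) \<and>
      upper_central G r a = one_plus_span (isolated_series \<Delta> r a)"
    and "normal_subset \<Delta> (isolated_series_end \<Delta> r) \<and>
      upper_central_end G r = one_plus_span (isolated_series_end \<Delta> r)"
proof -
  define P where "P \<Gamma> Z \<longleftrightarrow> normal_subset \<Delta> \<Gamma> \<and>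
    Z = (one_plus_span \<Gamma> :: ('r \<times> ('i \<times> 'i \<Rightarrow>\<^sub>0 'r)) set)" for \<Gamma> Z
  have as: "antisym r" using r by (auto simp: order_on_defs)
  \<comment> \<open>Successors are covered by \<open>central_step_pattern_group\<close>, the initial
    term by the trivial span, and limits by \<open>one_plus_span_Union_chain\<close>.\<close>
  have stage: "P (stage r {} (isolated_step \<Delta>) f A) (stage r {\<one>\<^bsub>G\<^esub>} (central_step G) g A)"
    if P: "\<And>b. b \<in> A \<Longrightarrow> P (f b) (g b)"
      and chain: "\<And>b c. b \<in> A \<Longrightarrow> c \<in> A \<Longrightarrow> f b \<subseteq> f c \<or> f c \<subseteq> f b" for A f g
  proof (cases "\<exists>m\<in>A. \<forall>b\<in>A. (b, m) \<in> r")
    case True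
    then obtain m where m: "m \<in> A" "\<And>b. b \<in> A \<Longrightarrow> (b, m) \<in> r" by blast
    then show ?thesis
      using P[OF m(1)]
      by (simp add: stage_greatest[OF as m] P_def G_def normal_subset_isolated_step
          central_step_pattern_group[OF \<Delta>])
  next
    case False
    show ?thesis
    proof (cases "A = {}")
      case True
      then show ?thesis
        by (simp add: stage_def P_def G_def normal_subset_empty one_plus_span_empty one_pattern_group)
    next
      case ne: False
      have "normal_subset \<Delta> (\<Union>b\<in>A. f b)"
        using P by (intro normal_subset_Union) (auto simp: P_def)
      then show ?thesis
        using P by (simp add: P_def stage_limit[OF ne False] one_plus_span_Union_chain[OF ne chain])
    qed
  qed
  note induct = iterate_induct[OF r _ isolated_step_inflationary, where P = P and z = "{}"
      and z' = "{\<one>\<^bsub>G\<^esub>}" and s' = "central_step G"]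
  have "P (isolated_series \<Delta> r a) (upper_central G r a)"
    unfolding isolated_series_def upper_central_def by (rule induct(1)) (rule stage)
  moreover have "P (isolated_series_end \<Delta> r) (upper_central_end G r)"
    unfolding isolated_series_end_def upper_central_end_def by (rule induct(2)) (rule stage)
  ultimately show "normal_subset \<Delta> (isolated_series \<Delta> r a) \<and>
      upper_central G r a = one_plus_span (isolated_series \<Delta> r a)"
    and "normal_subset \<Delta> (isolated_series_end \<Delta> r) \<and>
      upper_central_end G r = one_plus_span (isolated_series_end \<Delta> r)"
    by (auto simp: P_def)
qed

text \<open>The order is the one built so that the series of index sets ends at its least fixed
  point. Being a fixed point of \<open>isolated_step\<close>, this set yields a subgroup fixed by
  the central step.\<close>

lemma ex_upper_central_stabilizes:
  fixes \<Delta> :: "'i rel"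
  assumes \<Delta>: "admissible \<Lambda> \<Delta>"
  shows "\<exists>r. well_order_on \<Delta> r \<and> upper_central_stabilizes
    (pattern_group \<Delta> :: ('r::ring_1 \<times> ('i \<times> 'i \<Rightarrow>\<^sub>0 'r)) monoid) r
    (one_plus_span (lfp (isolated_step \<Delta>)))"
proof -
  have "isolated_step \<Delta> \<Delta> \<subseteq> \<Delta>" by (simp add: isolated_step_def isolated_def)
  then have "lfp (isolated_step \<Delta>) \<subseteq> \<Delta>" by (rule lfp_lowerbound)
  then obtain r where r: "well_order_on \<Delta> r"
    "iterate_end r {} (isolated_step \<Delta>) = lfp (isolated_step \<Delta>)"
    using ex_well_order_iterate_end_eq_lfp[OF mono_isolated_step isolated_step_inflationary]
    by blast
  have "Well_order r" using r(1) well_order_on_Well_order by blast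
  from upper_central_pattern_group(2)[OF \<Delta> this, where 'r = 'r] have
    "normal_subset \<Delta> (lfp (isolated_step \<Delta>))"
    "upper_central_end (pattern_group \<Delta> :: ('r \<times> ('i \<times> 'i \<Rightarrow>\<^sub>0 'r)) monoid) r =
      one_plus_span (lfp (isolated_step \<Delta>))"
    by (simp_all add: isolated_series_end_def r(2))
  then show ?thesis using r(1) central_step_pattern_group[OF \<Delta>, where 'r = 'r]
    by (auto simp: upper_central_stabilizes_def lfp_fixpoint[OF mono_isolated_step])
qed

section \<open>Three examples, whose series are stationary after at most one step\<close>

lemma lfp_isolated_step_eq_isolated:
  assumes "isolated (\<Delta> - isolated \<Delta>) = {}"
  shows "lfp (isolated_step \<Delta>) = isolated \<Delta>"
proof (rule antisym)
  show "lfp (isolated_step \<Delta>) \<subseteq> isolated \<Delta>"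
    by (rule lfp_lowerbound) (simp add: isolated_step_def assms)
  have "isolated \<Delta> \<subseteq> isolated_step \<Delta> (lfp (isolated_step \<Delta>))"
    using monoD[OF mono_isolated_step, of "{}"] by (auto simp: isolated_step_def)
  then show "isolated \<Delta> \<subseteq> lfp (isolated_step \<Delta>)"
    by (simp add: lfp_fixpoint[OF mono_isolated_step])
qed

lemma isolated_eq_empty:
  assumes "\<And>i j. (i, j) \<in> \<Delta> \<Longrightarrow> \<exists>k. (j, k) \<in> \<Delta> \<and> (i, k) \<in> \<Delta>"
  shows "isolated \<Delta> = {}"
  using assms unfolding isolated_def by blast

lemma ex_upper_central_trivial:
  "\<exists>(\<Lambda> :: nat set) \<Delta> r. admissible \<Lambda> \<Delta> \<and> well_order_on \<Delta> r \<and>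
     (let H = (pattern_group \<Delta> :: ('r::ring_1 \<times> (nat \<times> nat \<Rightarrow>\<^sub>0 'r)) monoid) in
        upper_central_stabilizes H r {\<one>\<^bsub>H\<^esub>} \<and> carrier H \<noteq> {\<one>\<^bsub>H\<^esub>})"
proof -
  \<comment> \<open>In the order of the natural numbers every pair \<open>(i, j)\<close> can be
    extended on the right by \<open>(j, Suc j)\<close>, so nothing is isolated.\<close>
  define \<Delta> where "\<Delta> = {(i :: nat, j). i < j}"
  have \<Delta>: "admissible UNIV \<Delta>"
    by (rule admissible_strict_order) (auto simp: \<Delta>_def trans_def irrefl_def)
  have ext: "(j, Suc j) \<in> \<Delta> \<and> (i, Suc j) \<in> \<Delta>" if "(i, j) \<in> \<Delta>" for i j
    using that by (auto simp: \<Delta>_def)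
  have iso: "isolated \<Delta> = {}" by (rule isolated_eq_empty) (use ext in blast)
  then have lfp: "lfp (isolated_step \<Delta>) = {}"
    by (subst lfp_isolated_step_eq_isolated) auto
  have "(0, 1) \<in> \<Delta>" by (simp add: \<Delta>_def)
  then have "{} \<subset> \<Delta>" by blast
  from one_plus_span_psubset[OF this, where 'r = 'r] show ?thesis
    using ex_upper_central_stabilizes[OF \<Delta>, where 'r = 'r] \<Delta>
    unfolding lfp one_plus_span_empty one_pattern_group carrier_pattern_group Let_def by blast
qed

lemma ex_upper_central_intermediate:
  "\<exists>(\<Lambda> :: nat set) \<Delta> r Z. admissible \<Lambda> \<Delta> \<and> well_order_on \<Delta> r \<and>
     (let H = (pattern_group \<Delta> :: ('r::ring_1 \<times> (nat \<times> nat \<Rightarrow>\<^sub>0 'r)) monoid) in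
        upper_central_stabilizes H r Z \<and> Z \<noteq> {\<one>\<^bsub>H\<^esub>} \<and> Z \<subset> carrier H)"
proof -
  \<comment> \<open>A copy of the previous example starting at \<open>2\<close>, hence sharing no
    index with the extra pair \<open>(0, 1)\<close>, which becomes the only isolated one.\<close>
  define T where "T = {(i :: nat, j). 2 \<le> i \<and> i < j}"
  define \<Delta> where "\<Delta> = insert (0, 1) T"
  have \<Delta>: "admissible UNIV \<Delta>"
    by (rule admissible_strict_order) (auto simp: \<Delta>_def T_def trans_def irrefl_def)
  have ext: "(j, Suc j) \<in> T \<and> (i, Suc j) \<in> T" if "(i, j) \<in> T" for i j
    using that by (auto simp: T_def)
  have T: "isolated T = {}" by (rule isolated_eq_empty) (use ext in blast)
  have "(0, 1) \<notin> T" by (simp add: T_def)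
  have iso: "isolated \<Delta> = {(0, 1)}"
  proof (intro equalityI subsetI)
    fix p assume p: "p \<in> isolated \<Delta>"
    show "p \<in> {(0, 1)}"
    proof (cases p)
      case (Pair i j)
      then have "(i, j) \<notin> T" using p ext[of i j] unfolding isolated_def \<Delta>_def by blast
      then show ?thesis using p isolated_subset[of \<Delta>] by (auto simp: Pair \<Delta>_def)
    qed
  next
    fix p :: "nat \<times> nat" assume "p \<in> {(0, 1)}"
    then show "p \<in> isolated \<Delta>" by (simp add: isolated_def \<Delta>_def T_def)
  qed
  have "\<Delta> - {(0, 1)} = T" using \<open>(0, 1) \<notin> T\<close> by (auto simp: \<Delta>_def)
  then have lfp: "lfp (isolated_step \<Delta>) = {(0, 1)}"
    using lfp_isolated_step_eq_isolated[of \<Delta>] by (simp add: iso T)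
  have "(2, 3) \<in> T" by (simp add: T_def)
  then have "{} \<subset> {(0 :: nat, 1 :: nat)}" "{(0, 1)} \<subset> \<Delta>"
    using \<open>(0, 1) \<notin> T\<close> by (auto simp: \<Delta>_def)
  note one_plus_span_psubset[OF this(1), where 'r = 'r]
    one_plus_span_psubset[OF this(2), where 'r = 'r]
  then show ?thesis
    using ex_upper_central_stabilizes[OF \<Delta>, where 'r = 'r] \<Delta>
    unfolding lfp one_plus_span_empty one_pattern_group carrier_pattern_group Let_def by blast
qed

lemma ex_upper_central_full:
  "\<exists>(\<Lambda> :: nat set) \<Delta> r. admissible \<Lambda> \<Delta> \<and> well_order_on \<Delta> r \<and>
     (let H = (pattern_group \<Delta> :: ('r::ring_1 \<times> (nat \<times> nat \<Rightarrow>\<^sub>0 'r)) monoid) in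
        upper_central_stabilizes H r (carrier H) \<and> carrier H \<noteq> {\<one>\<^bsub>H\<^esub>})"
proof -
  \<comment> \<open>The single pair is isolated, so the group is abelian and the series is complete
    after one step.\<close>
  let ?\<Delta> = "{(0 :: nat, 1 :: nat)}"
  have \<Delta>: "admissible UNIV ?\<Delta>"
    by (rule admissible_strict_order) (auto simp: trans_def irrefl_def)
  have "isolated ?\<Delta> = ?\<Delta>" by (auto simp: isolated_def)
  then have lfp: "lfp (isolated_step ?\<Delta>) = ?\<Delta>"
    by (subst lfp_isolated_step_eq_isolated) (auto simp: isolated_def)
  have "{} \<subset> ?\<Delta>" by blast
  from one_plus_span_psubset[OF this, where 'r = 'r] show ?thesis
    using ex_upper_central_stabilizes[OF \<Delta>, where 'r = 'r] \<Delta>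
    unfolding lfp one_plus_span_empty one_pattern_group carrier_pattern_group Let_def by blast
qed

theorem mainTheorem6:
  fixes \<Lambda> :: "'i set" and \<Delta> :: "'i rel"
  assumes "admissible \<Lambda> \<Delta>"
  defines "G \<equiv> (pattern_group :: 'i rel \<Rightarrow> ('r::ring_1 \<times> ('i \<times> 'i \<Rightarrow>\<^sub>0 'r)) monoid)"
  shows "(\<forall>\<Gamma>. normal_subset \<Delta> \<Gamma> \<longrightarrow> admissible \<Lambda> (\<Delta> - \<Gamma>)) \<and>
    (\<forall>\<Gamma>. normal_subset \<Delta> \<Gamma> \<longrightarrow>
       one_plus_span \<Gamma> \<lhd> G \<Delta> \<and> G \<Delta> Mod one_plus_span \<Gamma> \<cong> G (\<Delta> - \<Gamma>)) \<and>
    (normal_subset \<Delta> (isolated \<Delta>) \<and>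
       group_center (G \<Delta>) = one_plus_span (isolated \<Delta>)) \<and>
    (\<forall>\<C>. subset.chain {\<Gamma>. normal_subset \<Delta> \<Gamma>} \<C> \<longrightarrow> normal_subset \<Delta> (\<Union>\<C>)) \<and>
    (\<forall>r. well_order_on \<Delta> r \<longrightarrow>
       (\<forall>a\<in>\<Delta>. normal_subset \<Delta> (isolated_series \<Delta> r a) \<and>
          upper_central (G \<Delta>) r a = one_plus_span (isolated_series \<Delta> r a)) \<and>
       normal_subset \<Delta> (isolated_series_end \<Delta> r) \<and>
       upper_central_end (G \<Delta>) r = one_plus_span (isolated_series_end \<Delta> r)) \<and>
    (\<exists>r Z. well_order_on \<Delta> r \<and> upper_central_stabilizes (G \<Delta>) r Z) \<and>
    (\<exists>(\<Lambda>' :: nat set) \<Delta>' r. admissible \<Lambda>' \<Delta>' \<and> well_order_on \<Delta>' r \<and>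
       (let H = (pattern_group \<Delta>' :: ('r \<times> (nat \<times> nat \<Rightarrow>\<^sub>0 'r)) monoid) in
          upper_central_stabilizes H r {\<one>\<^bsub>H\<^esub>} \<and> carrier H \<noteq> {\<one>\<^bsub>H\<^esub>})) \<and>
    (\<exists>(\<Lambda>' :: nat set) \<Delta>' r Z. admissible \<Lambda>' \<Delta>' \<and> well_order_on \<Delta>' r \<and>
       (let H = (pattern_group \<Delta>' :: ('r \<times> (nat \<times> nat \<Rightarrow>\<^sub>0 'r)) monoid) in
          upper_central_stabilizes H r Z \<and> Z \<noteq> {\<one>\<^bsub>H\<^esub>} \<and> Z \<subset> carrier H)) \<and>
    (\<exists>(\<Lambda>' :: nat set) \<Delta>' r. admissible \<Lambda>' \<Delta>' \<and> well_order_on \<Delta>' r \<and>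
       (let H = (pattern_group \<Delta>' :: ('r \<times> (nat \<times> nat \<Rightarrow>\<^sub>0 'r)) monoid) in
          upper_central_stabilizes H r (carrier H) \<and> carrier H \<noteq> {\<one>\<^bsub>H\<^esub>}))"
proof -
  note \<Delta> = assms(1)
  show ?thesis
    unfolding G_def
  proof (intro conjI allI impI ballI)
    show "admissible \<Lambda> (\<Delta> - \<Gamma>)" if "normal_subset \<Delta> \<Gamma>" for \<Gamma>
      by (rule normal_subset_diff_admissible[OF \<Delta> that])
  next
    fix \<Gamma> assume \<Gamma>: "normal_subset \<Delta> \<Gamma>"
    \<comment> \<open>Normality and the isomorphism in (ii) both come from restriction to
      \<open>\<Delta> - \<Gamma>\<close>: its kernel is \<open>one_plus_span \<Gamma>\<close> and it
      is surjective.\<close>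
    note hom = restriction_hom[OF \<Delta> \<Gamma>, where 'r = 'r]
    show "one_plus_span \<Gamma> \<lhd> (pattern_group \<Delta> :: ('r \<times> ('i \<times> 'i \<Rightarrow>\<^sub>0 'r)) monoid)"
      using group_hom.normal_kernel[OF hom(1)] hom(2) by simp
    show "(pattern_group \<Delta> :: ('r \<times> ('i \<times> 'i \<Rightarrow>\<^sub>0 'r)) monoid) Mod one_plus_span \<Gamma> \<cong>
        (pattern_group (\<Delta> - \<Gamma>) :: ('r \<times> ('i \<times> 'i \<Rightarrow>\<^sub>0 'r)) monoid)"
      using group_hom.FactGroup_iso[OF hom(1,3)] hom(2) by simp
  next
    show "normal_subset \<Delta> (\<Union>\<C>)" if "subset.chain {\<Gamma>. normal_subset \<Delta> \<Gamma>} \<C>" for \<C>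
      using that by (intro normal_subset_Union) (auto simp: subset_chain_def)
  next
    fix r :: "('i \<times> 'i) rel" assume "well_order_on \<Delta> r"
    then have r: "Well_order r" using well_order_on_Well_order by blast
    note series = upper_central_pattern_group[OF \<Delta> r, where 'r = 'r]
    show "normal_subset \<Delta> (isolated_series \<Delta> r a)"
      "upper_central (pattern_group \<Delta> :: ('r \<times> ('i \<times> 'i \<Rightarrow>\<^sub>0 'r)) monoid) r a =
        one_plus_span (isolated_series \<Delta> r a)" for a
      using series(1) by auto
    show "normal_subset \<Delta> (isolated_series_end \<Delta> r)"
      "upper_central_end (pattern_group \<Delta> :: ('r \<times> ('i \<times> 'i \<Rightarrow>\<^sub>0 'r)) monoid) r =
        one_plus_span (isolated_series_end \<Delta> r)"
      using series(2) by auto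
  next
    show "\<exists>r Z. well_order_on \<Delta> r \<and>
        upper_central_stabilizes (pattern_group \<Delta> :: ('r \<times> ('i \<times> 'i \<Rightarrow>\<^sub>0 'r)) monoid) r Z"
      using ex_upper_central_stabilizes[OF \<Delta>, where 'r = 'r] by blast
  qed (rule normal_subset_isolated center_pattern_group[OF \<Delta>] ex_upper_central_trivial
      ex_upper_central_intermediate ex_upper_central_full)+
qed

end
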